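(* Let $\|\cdot\|$ be a norm on $\mathbb{R}^n$ with dual norm $\|\cdot\|_\star$. Let $\Theta\subseteq\mathbb{R}^n$ be a non-empty closed convex set, $\lambda>0$, and let $\psi\colon\Theta\to\mathbb{R}$ be differentiable and $\lambda$-strongly convex with respect to $\|\cdot\|_\star$. Let $X_1,\dots,X_T\subseteq\mathbb{R}^n$ be non-empty compact sets and $x_t\in X_t$ for $t=1,\dots,T$. Assume that there exists $B>0$ such that $$\max\left\{2^{5/2}\lambda\max_{c,c'\in\Theta}\|c-c'\|_\star^2,\ \max_{c,c'\in\Theta}\left(\psi(c)-\psi(c')\right)\right\}\le B^2.$$ Let $\hat c_1,\dots,\hat c_T\in\Theta$ be the outputs of the FTRL algorithm run on $(X_1,x_1),\dots,(X_T,x_T)$ with $\beta_t=\frac{2^{1/4}}{B}\sqrt{\frac{\sum_{i=1}^{t-1}\|g_i\|^2}{\lambda}}$. For any $c^*\in\Theta$, the linearized regret is bounded as $$R_T=\sum_{t=1}^T\langle g_t,\hat c_t-c^*\rangle\le2^{5/4}B\sqrt{\frac1\lambda\sum_{t=1}^T\|g_t\|^2}.$$ In particular, if for some $K>0$ we have $\|g_t\|=\|\hat x_t-x_t\|\le K$ for $t=1,\dots,T$, then $R_T\le2^{5/4}KB\sqrt{T/\lambda}$.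
   Context: $\langle\cdot,\cdot\rangle$ is the standard inner product on $\mathbb{R}^n$. FTRL algorithm: for $t=1,\dots,T$, output $\hat c_t\in\arg\min_{c\in\Theta}\ \beta_t\psi(c)+\sum_{i=1}^{t-1}\langle g_i,c\rangle$, where $\hat c_1\in\Theta$ is arbitrary and $\hat c_t=\hat c_{t-1}$ if $g_{t-1}=0$; then observe $(X_t,x_t)$; compute any $\hat x_t\in\arg\max_{x'\in X_t}\langle\hat c_t,x'\rangle$; set $g_t=\hat x_t-x_t$. The linearized regret $R_T$ equals the total loss over $T$ rounds, $\sum_{t=1}^T\left(\ell^{\mathrm{sub}}_t(\hat c_t)+\ell^{\mathrm{est}}_t(\hat c_t)\right)$, where $\ell^{\mathrm{sub}}_t(\hat c_t)=\langle\hat c_t,\hat x_t-x_t\rangle$ and $\ell^{\mathrm{est}}_t(\hat c_t)=\langle c^*,x_t-\hat x_t\rangle$. *)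

theory Defs
  imports "HOL-Analysis.Analysis"
begin

text \<open>The library's \<open>norm\<close> on \<open>real ^ 'n\<close> is the Euclidean one, so an arbitrary norm is a
  function satisfying the norm axioms.\<close>

definition is_norm :: "(real ^ 'n \<Rightarrow> real) \<Rightarrow> bool" where
  "is_norm N \<longleftrightarrow>
     (\<forall>x. 0 \<le> N x) \<and> (\<forall>x. N x = 0 \<longleftrightarrow> x = 0) \<and>
     (\<forall>a x. N (a *\<^sub>R x) = \<bar>a\<bar> * N x) \<and>
     (\<forall>x y. N (x + y) \<le> N x + N y)"

definition dual_norm :: "(real ^ 'n \<Rightarrow> real) \<Rightarrow> real ^ 'n \<Rightarrow> real" where
  "dual_norm N y = (SUP x\<in>{x. N x \<le> 1}. y \<bullet> x)"

text \<open>Strong convexity with modulus \<open>lam\<close> with respect to a norm \<open>N\<close>, in the form that makes sense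
  without a gradient; convexity of \<open>S\<close> is a separate hypothesis.\<close>

definition strongly_convex_on ::
    "(real ^ 'n \<Rightarrow> real) \<Rightarrow> real \<Rightarrow> (real ^ 'n) set \<Rightarrow> (real ^ 'n \<Rightarrow> real) \<Rightarrow> bool" where
  "strongly_convex_on N lam S f \<longleftrightarrow>
     (\<forall>x\<in>S. \<forall>y\<in>S. \<forall>u\<in>{0..1}.
        f (u *\<^sub>R x + (1 - u) *\<^sub>R y)
          \<le> u * f x + (1 - u) * f y - lam / 2 * u * (1 - u) * (N (x - y))\<^sup>2)"

text \<open>The sequences \<open>c\<close>, \<open>xh\<close>, \<open>g\<close> (predictions, induced actions, subgradients) form a possible run
  of follow-the-regularized-leader over rounds \<open>1..T\<close>.  Values at other indices are irrelevant.
  As \<open>\<beta>\<close> may depend on the past subgradients, it is passed as the sequence of values taken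
  along the run.\<close>

definition ftrl_run ::
    "(real ^ 'n) set \<Rightarrow> (real ^ 'n \<Rightarrow> real) \<Rightarrow> (nat \<Rightarrow> real) \<Rightarrow> nat \<Rightarrow>
     (nat \<Rightarrow> (real ^ 'n) set) \<Rightarrow> (nat \<Rightarrow> real ^ 'n) \<Rightarrow>
     (nat \<Rightarrow> real ^ 'n) \<Rightarrow> (nat \<Rightarrow> real ^ 'n) \<Rightarrow> (nat \<Rightarrow> real ^ 'n) \<Rightarrow> bool" where
  "ftrl_run \<Theta> \<psi> \<beta> T X x c xh g \<longleftrightarrow>
     (\<forall>t\<in>{1..T}.
        is_arg_min (\<lambda>v. \<beta> t * \<psi> v + (\<Sum>i=1..t-1. g i \<bullet> v)) (\<lambda>v. v \<in> \<Theta>) (c t) \<and>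
        (2 \<le> t \<longrightarrow> g (t - 1) = 0 \<longrightarrow> c t = c (t - 1)) \<and>
        is_arg_max (\<lambda>v. c t \<bullet> v) (\<lambda>v. v \<in> X t) (xh t) \<and>
        g t = xh t - x t)"

text \<open>Since the sum is empty for \<open>t = 1\<close>, this gives \<open>\<beta>\<^sub>1 = 0\<close>; the objective of round 1 then
  vanishes identically, and \<open>c 1\<close> is an arbitrary point of \<open>\<Theta>\<close>.\<close>

definition adaptive_beta ::
    "(real ^ 'n \<Rightarrow> real) \<Rightarrow> real \<Rightarrow> real \<Rightarrow> (nat \<Rightarrow> real ^ 'n) \<Rightarrow> nat \<Rightarrow> real" where
  "adaptive_beta N lam B g t =
     2 powr (1 / 4) / B * sqrt ((\<Sum>i=1..t-1. (N (g i))\<^sup>2) / lam)"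

definition loss_sub :: "real ^ 'n \<Rightarrow> real ^ 'n \<Rightarrow> real ^ 'n \<Rightarrow> real" where
  "loss_sub c xh x = c \<bullet> (xh - x)"

definition loss_est :: "real ^ 'n \<Rightarrow> real ^ 'n \<Rightarrow> real ^ 'n \<Rightarrow> real" where
  "loss_est cstar xh x = cstar \<bullet> (x - xh)"

definition linearized_regret ::
    "nat \<Rightarrow> real ^ 'n \<Rightarrow> (nat \<Rightarrow> real ^ 'n) \<Rightarrow> (nat \<Rightarrow> real ^ 'n) \<Rightarrow> (nat \<Rightarrow> real ^ 'n) \<Rightarrow> real" where
  "linearized_regret T cstar c xh x =
     (\<Sum>t=1..T. loss_sub (c t) (xh t) (x t) + loss_est cstar (xh t) (x t))"

end

theory Submission
  imports Defs
begin

text \<open>A minimizer of a strongly convex function has quadratic growth, so replacing the prediction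
  \<open>c t\<close> by any other point \<open>w\<close> of \<open>\<Theta>\<close> in the objective of round \<open>t\<close> costs at least
  \<open>\<beta> t * lam / 2 * d\<^sup>2\<close>, where \<open>d\<close> is the dual distance of \<open>c t\<close> and \<open>w\<close>. This quadratic
  term, the bound \<open>B / (2 powr (5 / 4) * sqrt lam)\<close> on \<open>d\<close>, and the choice of \<open>\<beta>\<close> make the loss
  of round \<open>t\<close> at most \<open>2 powr (1 / 4) * B / sqrt lam\<close> times the increment of the square root of
  the sum of \<open>(N (g i))\<^sup>2\<close>. These increments telescope, and the regularizer at the comparator
  contributes the same amount again.\<close>

lemma is_norm_nonneg: "is_norm N \<Longrightarrow> 0 \<le> N x"
  by (simp add: is_norm_def)

lemma is_norm_zero: "is_norm N \<Longrightarrow> N 0 = 0"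
  by (simp add: is_norm_def)

lemma is_norm_pos: "is_norm N \<Longrightarrow> x \<noteq> 0 \<Longrightarrow> 0 < N x"
  by (simp add: is_norm_def order_less_le)

lemma is_norm_scaleR: "is_norm N \<Longrightarrow> N (a *\<^sub>R x) = \<bar>a\<bar> * N x"
  by (simp add: is_norm_def)

lemma is_norm_triangle: "is_norm N \<Longrightarrow> N (x + y) \<le> N x + N y"
  by (simp add: is_norm_def)

text \<open>The norm axioms make \<open>N\<close> convex, and a finite convex function on the whole
  finite-dimensional space is continuous.\<close>

lemma is_norm_continuous_on:
  fixes N :: "real ^ 'n \<Rightarrow> real"
  assumes "is_norm N"
  shows "continuous_on S N"
proof -
  have "convex_on UNIV N"
  proof (rule convex_onI)
    fix t :: real and x y :: "real ^ 'n"
    assume "0 < t" "t < 1"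
    then show "N ((1 - t) *\<^sub>R x + t *\<^sub>R y) \<le> (1 - t) * N x + t * N y"
      using is_norm_triangle[OF assms, of "(1 - t) *\<^sub>R x" "t *\<^sub>R y"]
      by (simp add: is_norm_scaleR[OF assms])
  qed simp
  then have "continuous_on UNIV N"
    by (intro convex_on_continuous) auto
  then show ?thesis
    by (rule continuous_on_subset) simp
qed

text \<open>By compactness \<open>N\<close> attains a minimum on the Euclidean unit sphere, which is
  positive as the minimizer is nonzero; homogeneity extends the estimate to all vectors. This bounds
  the unit ball of \<open>N\<close>, over which \<open>dual_norm\<close> takes its supremum.\<close>

lemma is_norm_dominates_norm:
  fixes N :: "real ^ 'n \<Rightarrow> real"
  assumes "is_norm N"
  obtains C where "0 < C" "\<And>x. norm x \<le> C * N x"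
proof -
  have "sphere (0 :: real ^ 'n) 1 \<noteq> {}"
    using vector_choose_size[of 1] by (auto simp: sphere_def dist_norm)
  then obtain u where u: "u \<in> sphere 0 1" and min: "\<And>x. x \<in> sphere 0 1 \<Longrightarrow> N u \<le> N x"
    using continuous_attains_inf[OF compact_sphere _ is_norm_continuous_on[OF assms]] by blast
  have "u \<noteq> 0"
    using u by auto
  then have pos: "0 < N u"
    by (rule is_norm_pos[OF assms])
  have "norm x \<le> 1 / N u * N x" for x
  proof (cases "x = 0")
    case True
    then show ?thesis by (simp add: is_norm_zero[OF assms])
  next
    case False
    have "N u \<le> N ((1 / norm x) *\<^sub>R x)"
      using False by (intro min) simp
    also have "\<dots> = N x / norm x"
      by (simp add: is_norm_scaleR[OF assms])
    finally show ?thesis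
      using False pos by (simp add: field_simps)
  qed
  then show ?thesis
    using pos by (intro that[of "1 / N u"]) auto
qed

text \<open>Rescaling \<open>x\<close> to the unit sphere of \<open>N\<close> makes it a competitor
  in the supremum that defines \<open>dual_norm N y\<close>.\<close>

lemma inner_le_dual_norm:
  assumes "is_norm N"
  shows "x \<bullet> y \<le> N x * dual_norm N y"
proof (cases "x = 0")
  case True
  then show ?thesis by (simp add: is_norm_zero[OF assms])
next
  case False
  then have pos: "0 < N x"
    by (rule is_norm_pos[OF assms])
  obtain C where C: "0 < C" "\<And>z. norm z \<le> C * N z"
    using is_norm_dominates_norm[OF assms] by blast
  \<comment> \<open>A real supremum is an upper bound only if the set is bounded above.\<close>
  have "bdd_above ((\<lambda>z. y \<bullet> z) ` {z. N z \<le> 1})"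
  proof (rule bdd_aboveI2)
    fix z assume "z \<in> {z. N z \<le> 1}"
    then have "norm z \<le> C"
      using order_trans[OF C(2) mult_left_le[of "N z" C]] C(1) by simp
    then show "y \<bullet> z \<le> norm y * C"
      using norm_cauchy_schwarz[of y z] mult_left_mono[of "norm z" C "norm y"] by simp
  qed
  moreover have "N ((1 / N x) *\<^sub>R x) \<le> 1"
    using pos by (simp add: is_norm_scaleR[OF assms])
  ultimately have "y \<bullet> ((1 / N x) *\<^sub>R x) \<le> dual_norm N y"
    unfolding dual_norm_def by (intro cSUP_upper) auto
  then show ?thesis
    using pos by (simp add: field_simps inner_commute)
qed

text \<open>Minimality of \<open>c\<close> is tested against points of the segment from
  \<open>c\<close> to \<open>w\<close>. Strong convexity gives
  \<open>u * (1 - u) * Q \<le> u * D\<close>, where \<open>u\<close> is the weight of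
  \<open>w\<close>.\<close>

lemma is_arg_min_strongly_convex_growth:
  fixes N \<psi> :: "real ^ 'n \<Rightarrow> real"
  assumes sc: "strongly_convex_on N lam S \<psi>" and "convex S" and "0 \<le> b"
    and min: "is_arg_min (\<lambda>v. b * \<psi> v + z \<bullet> v) (\<lambda>v. v \<in> S) c" and "w \<in> S"
  shows "b * \<psi> c + z \<bullet> c + b * lam / 2 * (N (c - w))\<^sup>2 \<le> b * \<psi> w + z \<bullet> w"
proof -
  define Q where "Q = b * lam / 2 * (N (c - w))\<^sup>2"
  define D where "D = b * \<psi> w + z \<bullet> w - (b * \<psi> c + z \<bullet> c)"
  have c: "c \<in> S"
    using min by (simp add: is_arg_min_def)
  have bound: "(1 - u) * Q \<le> D" if u: "0 < u" "u < 1" for u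
  proof -
    define v where "v = (1 - u) *\<^sub>R c + u *\<^sub>R w"
    have "v \<in> S"
      unfolding v_def using \<open>convex S\<close> \<open>w \<in> S\<close> c u by (intro convexD) auto
    then have "b * \<psi> c + z \<bullet> c \<le> b * \<psi> v + z \<bullet> v"
      using min by (auto simp: is_arg_min_linorder)
    moreover have "b * \<psi> v
        \<le> b * ((1 - u) * \<psi> c + u * \<psi> w - lam / 2 * (1 - u) * u * (N (c - w))\<^sup>2)"
      using sc[unfolded strongly_convex_on_def, rule_format, OF c \<open>w \<in> S\<close>, of "1 - u"] u \<open>0 \<le> b\<close>
      unfolding v_def by (intro mult_left_mono) auto
    moreover have "z \<bullet> v = u * (z \<bullet> w) + (1 - u) * (z \<bullet> c)"
      by (simp add: v_def inner_add_right)
    ultimately have "u * ((1 - u) * Q) \<le> u * D"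
      unfolding Q_def D_def by (simp add: algebra_simps)
    then show ?thesis
      using u by simp
  qed
  \<comment> \<open>After division by \<open>u\<close>, letting \<open>u\<close> tend to 0 from the
    right removes the factor \<open>1 - u\<close>.\<close>
  have "((\<lambda>u. (1 - u) * Q) \<longlongrightarrow> (1 - 0) * Q) (at_right 0)"
    by (intro tendsto_intros)
  moreover have "eventually (\<lambda>u. (1 - u) * Q \<le> D) (at_right 0)"
    using eventually_at_right_real[OF zero_less_one] by eventually_elim (auto intro: bound)
  ultimately have "Q \<le> D"
    using tendsto_upperbound[of _ _ "at_right (0 :: real)" D] by force
  then show ?thesis
    by (simp add: Q_def D_def)
qed

text \<open>Induction on the number of rounds, with the comparator left arbitrary so that the next
  prediction can serve as comparator for the earlier rounds. The slack \<open>h t\<close> is what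
  the linear loss of round \<open>t\<close> retains after the quadratic growth is
  subtracted.\<close>

lemma ftrl_regret_bound:
  fixes \<psi> N :: "real ^ 'n \<Rightarrow> real" and c g :: "nat \<Rightarrow> real ^ 'n"
  assumes "strongly_convex_on N lam \<Theta> \<psi>" and "convex \<Theta>"
    and "\<And>t. 0 \<le> \<beta> t" and "\<And>t. \<beta> t \<le> \<beta> (Suc t)"
    and "\<And>w. w \<in> \<Theta> \<Longrightarrow> m \<le> \<psi> w"
    and "\<And>t. t \<in> {1..T} \<Longrightarrow>
      is_arg_min (\<lambda>v. \<beta> t * \<psi> v + (\<Sum>i=1..t-1. g i \<bullet> v)) (\<lambda>v. v \<in> \<Theta>) (c t)"
    and "\<And>t w. t \<in> {1..T} \<Longrightarrow> w \<in> \<Theta> \<Longrightarrow>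
      g t \<bullet> (c t - w) - \<beta> t * lam / 2 * (N (c t - w))\<^sup>2 \<le> h t"
    and "w \<in> \<Theta>"
  shows "(\<Sum>t=1..T. g t \<bullet> (c t - w)) \<le> \<beta> (Suc T) * (\<psi> w - m) + (\<Sum>t=1..T. h t)"
  using assms(6-8)
proof (induction T arbitrary: w)
  case 0
  then show ?case using assms(3)[of 1] assms(5)[of w] by simp
next
  case (Suc T)
  define G where "G = (\<Sum>i=1..T. g i)"
  let ?c = "c (Suc T)" and ?b = "\<beta> (Suc T)"
  have min: "is_arg_min (\<lambda>v. ?b * \<psi> v + G \<bullet> v) (\<lambda>v. v \<in> \<Theta>) ?c"
    using Suc.prems(1)[of "Suc T"] by (simp add: G_def inner_sum_left)
  then have "?c \<in> \<Theta>"
    by (simp add: is_arg_min_def)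
  \<comment> \<open>The bound for \<open>T\<close> rounds carries the weight
    \<open>\<beta> (Suc T)\<close>, the one in the objective that \<open>?c\<close> minimizes.
    Minimality therefore pays for exchanging \<open>?c\<close> for \<open>w\<close>.\<close>
  then have "(\<Sum>t=1..T. g t \<bullet> (c t - ?c)) \<le> ?b * (\<psi> ?c - m) + (\<Sum>t=1..T. h t)"
    using Suc.prems(1,2) by (intro Suc.IH) auto
  moreover have "(\<Sum>t=1..T. g t \<bullet> (c t - w))
      = (\<Sum>t=1..T. g t \<bullet> (c t - ?c)) + (G \<bullet> ?c - G \<bullet> w)"
    by (simp add: G_def inner_sum_left inner_diff_right sum_subtractf)
  moreover have "?b * \<psi> ?c + G \<bullet> ?c + ?b * lam / 2 * (N (?c - w))\<^sup>2 \<le> ?b * \<psi> w + G \<bullet> w"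
    using is_arg_min_strongly_convex_growth[OF assms(1,2) assms(3) min \<open>w \<in> \<Theta>\<close>] .
  moreover have "g (Suc T) \<bullet> (?c - w) - ?b * lam / 2 * (N (?c - w))\<^sup>2 \<le> h (Suc T)"
    using Suc.prems by simp
  moreover have "?b * (\<psi> w - m) \<le> \<beta> (Suc (Suc T)) * (\<psi> w - m)"
    using assms(4,5) Suc.prems(3) by (intro mult_right_mono) auto
  ultimately show ?case
    by (simp add: right_diff_distrib)
qed

text \<open>Here \<open>p\<close> and \<open>sqrt (p\<^sup>2 + a\<^sup>2)\<close> are the root sums of squares before and after a round, and
  \<open>e\<close> stands for \<open>B / sqrt lam\<close>.\<close>

lemma adaptive_step_bound:
  fixes a d e p r :: real
  assumes "0 \<le> a" "0 \<le> p" "0 < e" "0 < r" and r2: "r\<^sup>2 = sqrt 2" and d: "d \<le> e / (2 * r)"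
  shows "a * d - r * p / (2 * e) * d\<^sup>2 \<le> r * e * (sqrt (p\<^sup>2 + a\<^sup>2) - p)"
proof -
  define q where "q = sqrt (p\<^sup>2 + a\<^sup>2)"
  \<comment> \<open>Both sides are compared with \<open>a\<^sup>2 * e / (2 * r * M)\<close>; the
    maximum covers small \<open>p\<close>, where the quadratic term is too weak to help.\<close>
  define M where "M = max a p"
  have q: "q\<^sup>2 = p\<^sup>2 + a\<^sup>2" "p \<le> q"
    using assms by (auto simp: q_def real_le_rsqrt)
  have "a * d - r * p / (2 * e) * d\<^sup>2 \<le> r * e * (q - p)"
  proof (cases "M = 0")
    case True
    then have "a = 0" "p = 0"
      using assms by (auto simp: M_def max_def split: if_splits)
    then show ?thesis
      using q assms by simp
  next
    case False
    then have M: "0 < M"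
      using assms by (auto simp: M_def max_def split: if_splits)
    have "q \<le> sqrt (2 * M\<^sup>2)"
      unfolding q_def M_def using assms
      by (intro real_sqrt_le_mono) (auto simp: max_def intro!: power_mono add_mono)
    then have "q \<le> sqrt 2 * M"
      using M by (simp add: real_sqrt_mult)
    moreover have "1 * M \<le> sqrt 2 * M"
      using M by (intro mult_right_mono) auto
    moreover have "p \<le> M"
      by (simp add: M_def)
    ultimately have qp: "q + p \<le> 2 * sqrt 2 * M"
      by linarith
    have "a\<^sup>2 = (q - p) * (q + p)"
      using q by (simp add: algebra_simps power2_eq_square)
    also have "\<dots> \<le> (q - p) * (2 * sqrt 2 * M)"
      using qp q by (intro mult_left_mono) auto
    \<comment> \<open>The factor \<open>2 * sqrt 2\<close> is \<open>2 * r\<^sup>2\<close>, so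
      exactly one \<open>r\<close> survives the division by \<open>2 * r\<close>.\<close>
    finally have gap: "a\<^sup>2 * e / (2 * r * M) \<le> r * e * (q - p)"
      using M assms(3,4) mult_right_mono[of "a\<^sup>2" "(q - p) * (2 * sqrt 2 * M)" e]
      unfolding r2[symmetric] by (simp add: field_simps power2_eq_square)
    have "a * d - r * p / (2 * e) * d\<^sup>2 \<le> a\<^sup>2 * e / (2 * r * M)"
    proof (cases "a \<le> p")
      case True
      then have "M = p"
        by (simp add: M_def)
      \<comment> \<open>Completing the square in \<open>d\<close>: the left side of the goal is
        largest at \<open>d = a * e / (r * p)\<close>.\<close>
      have "0 \<le> (a * e - r * p * d)\<^sup>2 / (2 * e * r * p)"
        using M assms \<open>M = p\<close> by simp
      also have "\<dots> = a\<^sup>2 * e / (2 * r * p) - (a * d - r * p / (2 * e) * d\<^sup>2)"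
        using M assms \<open>M = p\<close> by (simp add: field_simps power2_eq_square)
      finally show ?thesis
        using \<open>M = p\<close> by simp
    next
      case False
      then have "M = a"
        by (simp add: M_def)
      have "0 \<le> r * p / (2 * e) * d\<^sup>2"
        using assms by simp
      \<comment> \<open>The quadratic term is dropped, and the diameter bound on \<open>d\<close>
        suffices.\<close>
      then have "a * d - r * p / (2 * e) * d\<^sup>2 \<le> a * (e / (2 * r))"
        using mult_left_mono[OF d \<open>0 \<le> a\<close>] by linarith
      also have "\<dots> = a\<^sup>2 * e / (2 * r * M)"
        using M \<open>M = a\<close> by (simp add: power2_eq_square)
      finally show ?thesis .
    qed
    then show ?thesis
      using gap by linarith
  qed
  then show ?thesis
    by (simp add: q_def)
qed

theorem proposition4p1:
  fixes N :: "real ^ 'n \<Rightarrow> real" and \<Theta> :: "(real ^ 'n) set" and \<psi> :: "real ^ 'n \<Rightarrow> real"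
    and lam B :: real and T :: nat
    and X :: "nat \<Rightarrow> (real ^ 'n) set" and x c xh g :: "nat \<Rightarrow> real ^ 'n"
    and cstar :: "real ^ 'n"
  assumes "is_norm N"
    and "\<Theta> \<noteq> {}" and "closed \<Theta>" and "convex \<Theta>"
    and "lam > 0"
    and "\<psi> differentiable_on \<Theta>" and "strongly_convex_on (dual_norm N) lam \<Theta> \<psi>"
    and "\<forall>t\<in>{1..T}. X t \<noteq> {} \<and> compact (X t) \<and> x t \<in> X t"
    and "B > 0"
    and "\<forall>v\<in>\<Theta>. \<forall>w\<in>\<Theta>. 2 powr (5 / 2) * lam * (dual_norm N (v - w))\<^sup>2 \<le> B\<^sup>2"
    and "\<forall>v\<in>\<Theta>. \<forall>w\<in>\<Theta>. \<psi> v - \<psi> w \<le> B\<^sup>2"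
    and "ftrl_run \<Theta> \<psi> (adaptive_beta N lam B g) T X x c xh g"
    and "cstar \<in> \<Theta>"
  shows "linearized_regret T cstar c xh x = (\<Sum>t=1..T. g t \<bullet> (c t - cstar)) \<and>
    linearized_regret T cstar c xh x
      \<le> 2 powr (5 / 4) * B * sqrt (1 / lam * (\<Sum>t=1..T. (N (g t))\<^sup>2)) \<and>
    (\<forall>K>0. (\<forall>t\<in>{1..T}. N (g t) \<le> K) \<longrightarrow>
      linearized_regret T cstar c xh x \<le> 2 powr (5 / 4) * K * B * sqrt (real T / lam))"
proof -
  define r :: real where "r = 2 powr (1 / 4)"
  define e where "e = B / sqrt lam"
  define P where "P = (\<lambda>t. sqrt (\<Sum>i=1..t. (N (g i))\<^sup>2))"
  define \<beta> where "\<beta> = adaptive_beta N lam B g"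
  have r: "0 < r" "r\<^sup>2 = sqrt 2"
    by (simp_all add: r_def powr_power powr_half_sqrt)
  have e: "0 < e"
    using assms(5,9) by (simp add: e_def)
  have powr: "2 powr (5 / 4) = 2 * r" "2 powr (5 / 2) = 4 * r\<^sup>2"
    unfolding r(2) by (simp_all add: r_def powr_add[of 2 1 "1 / 4", simplified]
        powr_add[of 2 2 "1 / 2", simplified] powr_half_sqrt)
  have \<beta>: "\<beta> t = r / B * (P (t - 1) / sqrt lam)" for t
    by (simp add: \<beta>_def adaptive_beta_def P_def r_def real_sqrt_divide)
  have \<beta>_lam: "\<beta> t * lam = r * P (t - 1) / e" for t
  proof -
    have "lam = sqrt lam * sqrt lam"
      using assms(5) by simp
    then show ?thesis
      unfolding \<beta> e_def using assms(5,9) by (simp add: field_simps)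
  qed
  have P_nonneg: "0 \<le> P t" for t
    by (simp add: P_def sum_nonneg)
  have P_Suc: "P (Suc t) = sqrt ((P t)\<^sup>2 + (N (g (Suc t)))\<^sup>2)" for t
    by (simp add: P_def sum_nonneg)
  have run: "is_arg_min (\<lambda>v. \<beta> t * \<psi> v + (\<Sum>i=1..t-1. g i \<bullet> v)) (\<lambda>v. v \<in> \<Theta>) (c t)"
    "g t = xh t - x t" if "t \<in> {1..T}" for t
    using assms(12) that by (auto simp: ftrl_run_def \<beta>_def)
  have step: "g t \<bullet> (c t - w) - \<beta> t * lam / 2 * (dual_norm N (c t - w))\<^sup>2
      \<le> r * e * (P t - P (t - 1))" if t: "t \<in> {1..T}" and w: "w \<in> \<Theta>" for t w
  proof -
    define d where "d = dual_norm N (c t - w)"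
    have ct: "c t \<in> \<Theta>"
      using run(1)[OF t] by (simp add: is_arg_min_def)
    have hoelder: "g t \<bullet> (c t - w) \<le> N (g t) * d"
      unfolding d_def by (rule inner_le_dual_norm[OF assms(1)])
    \<comment> \<open>As \<open>2 powr (5 / 2) = 4 * r\<^sup>2\<close>, taking roots turns the
      diameter hypothesis into exactly the bound that \<open>adaptive_step_bound\<close> asks
      for.\<close>
    have "4 * r\<^sup>2 * lam * d\<^sup>2 \<le> B\<^sup>2"
      using assms(10) w ct by (simp add: d_def powr)
    then have "(2 * r * sqrt lam * d)\<^sup>2 \<le> B\<^sup>2"
      using assms(5) by (simp add: power_mult_distrib)
    then have "2 * r * sqrt lam * d \<le> B"
      by (rule power2_le_imp_le) (use assms(9) in simp)
    then have "d \<le> e / (2 * r)"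
      using r assms(5) by (simp add: e_def field_simps)
    then have "N (g t) * d - r * P (t - 1) / (2 * e) * d\<^sup>2
        \<le> r * e * (sqrt ((P (t - 1))\<^sup>2 + (N (g t))\<^sup>2) - P (t - 1))"
      using r e P_nonneg is_norm_nonneg[OF assms(1)] by (intro adaptive_step_bound) auto
    moreover have "sqrt ((P (t - 1))\<^sup>2 + (N (g t))\<^sup>2) = P t"
      using P_Suc[of "t - 1"] t by simp
    moreover have "\<beta> t * lam / 2 * d\<^sup>2 = r * P (t - 1) / (2 * e) * d\<^sup>2"
      by (simp add: \<beta>_lam)
    ultimately show ?thesis
      using hoelder by (simp add: d_def)
  qed
  have telescope: "(\<Sum>t=1..n. r * e * (P t - P (t - 1))) = r * e * P n" for n
    by (induction n) (auto simp: P_def algebra_simps)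
  \<comment> \<open>The lower bound \<open>m = \<psi> cstar - B\<^sup>2\<close> makes the range of
    the regularizer exactly \<open>B\<^sup>2\<close>; the regularizer term and the telescoped sum
    then each equal \<open>r * e * P T\<close>.\<close>
  have "(\<Sum>t=1..T. g t \<bullet> (c t - cstar))
      \<le> \<beta> (Suc T) * (\<psi> cstar - (\<psi> cstar - B\<^sup>2)) + (\<Sum>t=1..T. r * e * (P t - P (t - 1)))"
  proof (rule ftrl_regret_bound[OF assms(7,4)])
    show "\<beta> t \<le> \<beta> (Suc t)" for t
    proof -
      have "P (t - 1) \<le> P t"
        unfolding P_def by (intro real_sqrt_le_mono sum_mono2) auto
      then show ?thesis
        unfolding \<beta> using r assms(5,9) by (intro mult_left_mono divide_right_mono) auto
    qed
    show "0 \<le> \<beta> t" for t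
      unfolding \<beta> using r assms(5,9) P_nonneg by simp
    show "\<psi> cstar - B\<^sup>2 \<le> \<psi> w" if "w \<in> \<Theta>" for w
      using assms(11,13) that by (auto simp: algebra_simps)
  qed (use run step assms(13) in auto)
  also have "\<dots> = 2 * r * e * P T"
    unfolding telescope \<beta> using assms(5,9) by (simp add: e_def field_simps power2_eq_square)
  finally have regret: "(\<Sum>t=1..T. g t \<bullet> (c t - cstar)) \<le> 2 * r * e * P T" .
  have eq: "linearized_regret T cstar c xh x = (\<Sum>t=1..T. g t \<bullet> (c t - cstar))"
    unfolding linearized_regret_def
    by (intro sum.cong) (auto simp: run loss_sub_def loss_est_def inner_diff inner_commute)
  have main: "linearized_regret T cstar c xh x
      \<le> 2 powr (5 / 4) * B * sqrt (1 / lam * (\<Sum>t=1..T. (N (g t))\<^sup>2))"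
    using regret by (simp add: eq powr e_def P_def real_sqrt_divide)
  have "linearized_regret T cstar c xh x \<le> 2 powr (5 / 4) * K * B * sqrt (real T / lam)"
    if K: "0 < K" "\<forall>t\<in>{1..T}. N (g t) \<le> K" for K
  proof -
    have "(\<Sum>t=1..T. (N (g t))\<^sup>2) \<le> (\<Sum>t=1..T. K\<^sup>2)"
      using K is_norm_nonneg[OF assms(1)] by (intro sum_mono power_mono) auto
    then have "1 / lam * (\<Sum>t=1..T. (N (g t))\<^sup>2) \<le> K\<^sup>2 * (real T / lam)"
      using assms(5) by (simp add: field_simps)
    then have "sqrt (1 / lam * (\<Sum>t=1..T. (N (g t))\<^sup>2)) \<le> sqrt (K\<^sup>2 * (real T / lam))"
      by (rule real_sqrt_le_mono)
    also have "\<dots> = K * sqrt (real T / lam)"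
      using K by (simp only: real_sqrt_mult real_sqrt_abs)
    finally have "2 powr (5 / 4) * B * sqrt (1 / lam * (\<Sum>t=1..T. (N (g t))\<^sup>2))
        \<le> 2 powr (5 / 4) * B * (K * sqrt (real T / lam))"
      using assms(9) by (intro mult_left_mono) auto
    then show ?thesis
      using main by (simp add: mult_ac)
  qed
  then show ?thesis
    using eq main by blast
qed

end
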